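(* Let $\kappa_2:\mathrm{Cop}(2)\to\mathbb{R}$ be a bivariate measure of concordance in the sense of Scarsini. For $p\ge 1$ define $\kappa_{2+p}:\mathrm{Cop}(2+p)\to\mathbb{R}$ by $$\kappa_{2+p}(C)=\frac{1}{\binom{2+p}{2}}\sum_{R\subseteq\{1,\dots,2+p\},\ \mathrm{card}(R)=p}\kappa_2(C_R).$$ Then $\kappa=(\{\kappa_n\},\{r_n\})_{n=2}^{\infty}$ is a (multivariate) measure of concordance, with $r_{1+p}=\dfrac{2p}{2+p}$ for $p\ge1$.
   Context: Notation. $I=[0,1]$, $\overline{n}=\{1,\dots,n\}$, and $[0,x]=[0,x_1]\times\cdots\times[0,x_n]$ for $x\in I^n$. For $n\ge 1$ an $n$-copula is a function $C:I^n\to I$ for which there is a (necessarily unique) Borel probability measure $\mu_C$ on $I^n$ whose one-dimensional marginals are all Lebesgue measure on $I$ and which satisfies $\mu_C([0,x])=C(x)$. $\mathrm{Cop}(n)$ is the set of $n$-copulas; $M(t_1,\dots,t_n)=\min(t_1,\dots,t_n)$ and $\Pi(t_1,\dots,t_n)=t_1\cdots t_n$. Symmetries. A permutation of $I^n$ is a map $\tau(x_1,\dots,x_n)=(x_{\tau'(1)},\dots,x_{\tau'(n)})$, where $\tau'$ is a permutation of $\overline n$. The elementary reflection $\sigma_i$ of $I^n$ replaces $x_i$ by $1-x_i$ and fixes the other coordinates; $\mathcal{R}_n$ is the group of reflections (compositions of elementary reflections, including the identity), and $\sigma=\sigma_1\sigma_2\cdots\sigma_n$. For a permutation or reflection $\xi$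 of $I^n$ and an $n$-copula $C$, $\xi^*(C)$ is the $n$-copula $[\xi^*(C)](x)=\mu_C(\xi([0,x]))$. For $n$-copulas $A,B$, $A\prec_{\mathcal C}B$ means $A\le B$ and $\sigma^*(A)\le\sigma^*(B)$ pointwise. Marginals. For $C\in\mathrm{Cop}(n)$ and $S\subseteq\overline n$ with $s=\mathrm{card}(S)$, $C_S:I^n\to I$ is the function obtained from $C$ by setting $x_i=1$ for all $i\in S$. Its proper copula is the $(n-s)$-copula obtained by regarding $C_S$ as a function of the remaining variables $x_i$, $i\notin S$, listed in increasing order of index; $\kappa_{n-s}(C_S)$ means $\kappa_{n-s}$ of this proper copula. A bivariate measure of concordance in the sense of Scarsini is a map $\kappa_2:\mathrm{Cop}(2)\to\mathbb R$ such that, for 2-copulas: $\kappa_2(M)=1$ and $\kappa_2(\Pi)=0$; if $C_m\to C$ uniformly then $\kappa_2(C_m)\to\kappa_2(C)$; $\kappa_2(\tau^*(C))=\kappa_2(C)$ for every permutation $\tau$ of $I^2$; if $A\prec_{\mathcal C}B$ then $\kappa_2(A)\le\kappa_2(B)$; and $\kappa_2(\sigma_1^*(C))=\kappa_2(\sigma_2^*(C))=-\kappa_2(C)$. A (multivariate) measure of concordance $\kappa=(\{\kappa_n\},\{r_n\})$ consists of maps $\kappa_n:\mathrm{Cop}(n)\to\mathbb R$ and real numbers $r_n$, $n\ge2$, such that for all $n\ge 2$ and all $n$-copulas $A,B,C,C_m$: A1 (Normalization) $\kappa_n(M)=1$, $\kappa_n(\Pi)=0$; A2 (Monotonicity) if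 $A\prec_{\mathcal C}B$ then $\kappa_n(A)\le\kappa_n(B)$; A3 (Continuity) if $C_m\to C$ uniformly then $\kappa_n(C_m)\to\kappa_n(C)$ as $m\to\infty$; A4 (Permutation Invariance) $\kappa_n(\tau^*(C))=\kappa_n(C)$ for every permutation $\tau$ of $I^n$; A5 (Duality) $\kappa_n(\sigma^*(C))=\kappa_n(C)$; A6 (Reflection Symmetry Property) $\sum_{\rho\in\mathcal R_n}\kappa_n(\rho^*(C))=0$; A7 (Transition Property) $r_n\kappa_n(C)=\kappa_{n+1}(E)+\kappa_{n+1}(\sigma_1^*(E))$ whenever $E$ is an $(n+1)$-copula with $C(x_1,\dots,x_n)=E(1,x_1,\dots,x_n)$. *)

theory Defs
  imports "HOL-Probability.Probability"
begin

text \<open>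
  The dimension varies inside the statement, so a point of \<open>I\<^sup>n\<close> is a function on the indices
  \<open>{1..n}\<close>, extended by \<open>undefined\<close> outside. Likewise an \<open>n\<close>-copula is a function on
  \<open>I\<^sup>n\<close>, extended by \<open>undefined\<close>, so that equality of copulas is equality on \<open>I\<^sup>n\<close>.
\<close>

type_synonym point = "nat \<Rightarrow> real"
type_synonym copula = "point \<Rightarrow> real"

definition icube :: "nat \<Rightarrow> point set" where
  "icube n = {1..n} \<rightarrow>\<^sub>E {0..1}"

definition lower_box :: "nat \<Rightarrow> point \<Rightarrow> point set" where
  "lower_box n x = (\<Pi>\<^sub>E i\<in>{1..n}. {0..x i})"

definition copula_measure :: "nat \<Rightarrow> copula \<Rightarrow> point measure \<Rightarrow> bool" where
  "copula_measure n C \<mu> \<longleftrightarrow>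
     prob_space \<mu> \<and>
     sets \<mu> = sets (\<Pi>\<^sub>M i\<in>{1..n}. restrict_space borel {0..1::real}) \<and>
     (\<forall>i\<in>{1..n}. distr \<mu> (restrict_space borel {0..1}) (\<lambda>x. x i) = restrict_space lborel {0..1}) \<and>
     (\<forall>x\<in>icube n. measure \<mu> (lower_box n x) = C x)"

definition Cop :: "nat \<Rightarrow> copula set" where
  "Cop n = {C \<in> icube n \<rightarrow>\<^sub>E {0..1}. \<exists>\<mu>. copula_measure n C \<mu>}"

text \<open>The measure is unique because the boxes \<open>[0,x]\<close> form a generating \<open>\<inter>\<close>-stable system.\<close>

definition mu :: "nat \<Rightarrow> copula \<Rightarrow> point measure" where
  "mu n C = (THE \<mu>. copula_measure n C \<mu>)"

definition M_cop :: "nat \<Rightarrow> copula" where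
  "M_cop n = (\<lambda>x\<in>icube n. MIN i\<in>{1..n}. x i)"

definition Pi_cop :: "nat \<Rightarrow> copula" where
  "Pi_cop n = (\<lambda>x\<in>icube n. \<Prod>i\<in>{1..n}. x i)"

text \<open>
  Symmetries are written as maps on all of \<open>nat \<Rightarrow> real\<close>; those below map \<open>I\<^sup>n\<close> onto itself
  and are determined by their restriction to \<open>I\<^sup>n\<close>.
\<close>

definition perm_map :: "(nat \<Rightarrow> nat) \<Rightarrow> point \<Rightarrow> point" where
  "perm_map t x = (\<lambda>i. x (t i))"

definition permutations_of_cube :: "nat \<Rightarrow> (point \<Rightarrow> point) set" where
  "permutations_of_cube n = {perm_map t | t. t permutes {1..n}}"

definition elem_refl :: "nat \<Rightarrow> point \<Rightarrow> point" where
  "elem_refl i x = x(i := 1 - x i)"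

inductive_set reflections :: "nat \<Rightarrow> (point \<Rightarrow> point) set" for n :: nat where
  "id \<in> reflections n"
| "\<lbrakk>\<rho> \<in> reflections n; i \<in> {1..n}\<rbrakk> \<Longrightarrow> elem_refl i \<circ> \<rho> \<in> reflections n"

definition full_refl :: "nat \<Rightarrow> point \<Rightarrow> point" where
  "full_refl n = foldr (\<circ>) (map elem_refl [1..<Suc n]) id"

definition pull :: "nat \<Rightarrow> (point \<Rightarrow> point) \<Rightarrow> copula \<Rightarrow> copula" where
  "pull n \<xi> C = (\<lambda>x\<in>icube n. measure (mu n C) (\<xi> ` lower_box n x))"

definition conc_le :: "nat \<Rightarrow> copula \<Rightarrow> copula \<Rightarrow> bool" where
  "conc_le n A B \<longleftrightarrow>
     (\<forall>x\<in>icube n. A x \<le> B x) \<and>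
     (\<forall>x\<in>icube n. pull n (full_refl n) A x \<le> pull n (full_refl n) B x)"

definition marginal :: "nat \<Rightarrow> nat set \<Rightarrow> copula \<Rightarrow> copula" where
  "marginal n S C = (\<lambda>x\<in>icube n. C (\<lambda>i. if i \<in> S then 1 else x i))"

text \<open>
  For \<open>i \<notin> S\<close>, the number of \<open>j \<in> {1..n} - S\<close> with \<open>j \<le> i\<close> is the position of \<open>i\<close> in the
  increasing list of the remaining indices. The coordinates in \<open>S\<close> do not influence
  \<open>marginal n S C\<close>; they are filled with \<open>1\<close> only to obtain a point of \<open>I\<^sup>n\<close>.
\<close>

definition proper_copula :: "nat \<Rightarrow> nat set \<Rightarrow> copula \<Rightarrow> copula" where
  "proper_copula n S C =
     (\<lambda>y\<in>icube (n - card S).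
        marginal n S C
          (\<lambda>i\<in>{1..n}. if i \<in> S then 1 else y (card {j \<in> {1..n} - S. j \<le> i})))"

definition scarsini_measure :: "(copula \<Rightarrow> real) \<Rightarrow> bool" where
  "scarsini_measure \<kappa> \<longleftrightarrow>
     \<kappa> (M_cop 2) = 1 \<and> \<kappa> (Pi_cop 2) = 0 \<and>
     (\<forall>Cm C. (\<forall>m. Cm m \<in> Cop 2) \<longrightarrow> C \<in> Cop 2 \<longrightarrow>
        uniform_limit (icube 2) Cm C sequentially \<longrightarrow> (\<lambda>m. \<kappa> (Cm m)) \<longlonglongrightarrow> \<kappa> C) \<and>
     (\<forall>C\<in>Cop 2. \<forall>\<tau>\<in>permutations_of_cube 2. \<kappa> (pull 2 \<tau> C) = \<kappa> C) \<and>
     (\<forall>A\<in>Cop 2. \<forall>B\<in>Cop 2. conc_le 2 A B \<longrightarrow> \<kappa> A \<le> \<kappa> B) \<and>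
     (\<forall>C\<in>Cop 2. \<kappa> (pull 2 (elem_refl 1) C) = - \<kappa> C \<and> \<kappa> (pull 2 (elem_refl 2) C) = - \<kappa> C)"

definition cons_one :: "nat \<Rightarrow> point \<Rightarrow> point" where
  "cons_one n x = (\<lambda>i\<in>{1..n + 1}. if i = 1 then 1 else x (i - 1))"

text \<open>The conjuncts are, in order: normalization, monotonicity, continuity, permutation invariance,
  duality, reflection symmetry, transition.\<close>

definition measure_of_concordance :: "(nat \<Rightarrow> copula \<Rightarrow> real) \<Rightarrow> (nat \<Rightarrow> real) \<Rightarrow> bool" where
  "measure_of_concordance \<kappa> r \<longleftrightarrow> (\<forall>n\<ge>2.
     (\<kappa> n (M_cop n) = 1 \<and> \<kappa> n (Pi_cop n) = 0) \<and>
     (\<forall>A\<in>Cop n. \<forall>B\<in>Cop n. conc_le n A B \<longrightarrow> \<kappa> n A \<le> \<kappa> n B) \<and>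
     (\<forall>Cm C. (\<forall>m. Cm m \<in> Cop n) \<longrightarrow> C \<in> Cop n \<longrightarrow>
        uniform_limit (icube n) Cm C sequentially \<longrightarrow> (\<lambda>m. \<kappa> n (Cm m)) \<longlonglongrightarrow> \<kappa> n C) \<and>
     (\<forall>C\<in>Cop n. \<forall>\<tau>\<in>permutations_of_cube n. \<kappa> n (pull n \<tau> C) = \<kappa> n C) \<and>
     (\<forall>C\<in>Cop n. \<kappa> n (pull n (full_refl n) C) = \<kappa> n C) \<and>
     (\<forall>C\<in>Cop n. (\<Sum>\<rho>\<in>reflections n. \<kappa> n (pull n \<rho> C)) = 0) \<and>
     (\<forall>C\<in>Cop n. \<forall>E\<in>Cop (n + 1). (\<forall>x\<in>icube n. C x = E (cons_one n x)) \<longrightarrow>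
        r n * \<kappa> n C = \<kappa> (n + 1) E + \<kappa> (n + 1) (pull (n + 1) (elem_refl 1) E)))"

end

theory Submission
  imports Defs
begin

text \<open>
  Permutations, reflections and marginals of an \<open>n\<close>-copula all arise by pushing its measure forward
  along a map whose coordinates are \<open>x (f i)\<close> or \<open>1 - x (f i)\<close>; this class of maps is closed under
  composition and preserves uniform marginals. By the symmetry of \<open>\<kappa>\<^sub>2\<close>, \<open>\<kappa> n C\<close> is the average of
  \<open>\<kappa>\<^sub>2\<close> over the bivariate marginals of \<open>C\<close> at all ordered pairs of distinct indices, so permutation
  invariance is a reindexing of pairs. Reflecting in coordinate \<open>a\<close> changes the sign of \<open>\<kappa>\<^sub>2\<close> on
  exactly the pairs containing \<open>a\<close>. Hence, for a fixed pair, the sum over all reflections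
  cancels, and in the transition property the \<open>n * (n - 1)\<close> pairs avoiding index 1 survive twice out
  of \<open>(n + 1) * n\<close>.
\<close>

declare One_nat_def [simp del]

section \<open>The measurable cube, its lower boxes, and uniqueness of the measure of a
  copula\<close>

abbreviation unit_borel :: "real measure" where
  "unit_borel \<equiv> restrict_space borel {0..1}"

abbreviation unit_uniform :: "real measure" where
  "unit_uniform \<equiv> restrict_space lborel {0..1}"

abbreviation cube :: "nat \<Rightarrow> point measure" where
  "cube n \<equiv> \<Pi>\<^sub>M i\<in>{1..n}. unit_borel"

lemma space_cube [simp]: "space (cube n) = icube n"
  by (simp add: space_PiM icube_def space_restrict_space)

lemma sets_unit_uniform: "sets unit_uniform = sets unit_borel"
  by (simp add: sets_restrict_space)

lemma prob_space_unit_uniform: "prob_space unit_uniform"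
  by (rule prob_spaceI) (simp add: space_restrict_space emeasure_restrict_space)

lemma icube_bounds:
  assumes "x \<in> icube n" "i \<in> {1..n}"
  shows "0 \<le> x i" "x i \<le> 1"
  using PiE_mem[of x "{1..n}" "\<lambda>_. {0..1}" i] assms by (auto simp: icube_def)

lemma icube_iff:
  "x \<in> icube n \<longleftrightarrow> x \<in> extensional {1..n} \<and> (\<forall>i\<in>{1..n}. 0 \<le> x i \<and> x i \<le> 1)"
  by (auto simp: icube_def PiE_iff)

lemma lower_box_iff:
  "x \<in> icube n \<Longrightarrow> x \<in> lower_box n y \<longleftrightarrow> (\<forall>i\<in>{1..n}. x i \<le> y i)"
  by (auto simp: lower_box_def icube_def PiE_iff)

lemma lower_box_subset_icube:
  assumes "y \<in> icube n" shows "lower_box n y \<subseteq> icube n"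
proof
  fix x assume "x \<in> lower_box n y"
  then show "x \<in> icube n"
    using icube_bounds[OF assms] by (fastforce simp: lower_box_def icube_def PiE_iff)
qed

lemma lower_box_eq:
  "y \<in> icube n \<Longrightarrow> lower_box n y = {x \<in> icube n. \<forall>i\<in>{1..n}. x i \<le> y i}"
  using lower_box_iff lower_box_subset_icube by blast

lemma lower_box_sets:
  assumes "y \<in> icube n" shows "lower_box n y \<in> sets (cube n)"
proof -
  have "{0..y i} \<in> sets unit_borel" if "i \<in> {1..n}" for i
    using icube_bounds[OF assms that] by (auto simp: sets_restrict_space_iff)
  then show ?thesis
    unfolding lower_box_def by (intro sets_PiM_I_finite) auto
qed

text \<open>The product sigma-algebra is generated by the slabs \<open>x i \<le> a\<close>. For
  \<open>a\<close> in the unit interval such a slab is the lower box with corner \<open>a\<close> at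
  \<open>i\<close> and 1 elsewhere; for other \<open>a\<close> it is empty or the whole cube. So
  every coordinate is measurable for the sigma-algebra of the boxes.\<close>

lemma sets_cube_eq: "sets (cube n) = sigma_sets (icube n) (lower_box n ` icube n)"
proof
  let ?N = "sigma (icube n) (lower_box n ` icube n)"
  have sub: "lower_box n ` icube n \<subseteq> Pow (icube n)"
    using lower_box_subset_icube by auto
  have comp: "(\<lambda>x. x i) \<in> measurable ?N unit_borel" if i: "i \<in> {1..n}" for i
  proof (rule measurable_restrict_space2)
    show "(\<lambda>x. x i) \<in> space ?N \<rightarrow> {0..1}"
      using icube_bounds[OF _ i] by (auto simp: space_measure_of[OF sub])
    have "{x \<in> icube n. x i \<le> a} \<in> sigma_sets (icube n) (lower_box n ` icube n)" for a
    proof (cases "0 \<le> a \<and> a \<le> 1")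
      case True
      let ?y = "\<lambda>j\<in>{1..n}. if j = i then a else 1"
      have y: "?y \<in> icube n" using True by (auto simp: icube_def)
      have "{x \<in> icube n. x i \<le> a} = lower_box n ?y"
        unfolding lower_box_eq[OF y] using i by (auto simp: icube_iff)
      then show ?thesis using y by (auto intro: sigma_sets.Basic)
    next
      case False
      then consider "a < 0" | "1 < a" by linarith
      then show ?thesis
      proof cases
        case 1
        then have "{x \<in> icube n. x i \<le> a} = {}"
          using icube_bounds(1)[OF _ i] by (auto simp: not_le intro: less_le_trans)
        then show ?thesis by (simp only: sigma_sets.Empty)
      next
        case 2
        then have "{x \<in> icube n. x i \<le> a} = icube n"
          using icube_bounds(2)[OF _ i] by (auto intro: order_trans less_imp_le)
        then show ?thesis by (simp only: sigma_sets_top)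
      qed
    qed
    then show "(\<lambda>x. x i) \<in> borel_measurable ?N"
      unfolding borel_measurable_iff_le by (simp add: space_measure_of[OF sub] sets_measure_of[OF sub])
  qed
  have "sets (cube n) \<subseteq> sets ?N"
  proof (rule sets_PiM_in_sets)
    show "space ?N = (\<Pi>\<^sub>E i\<in>{1..n}. space unit_borel)"
      using sub by (simp add: space_measure_of icube_def space_restrict_space)
    fix i A assume "i \<in> {1..n}" "A \<in> sets unit_borel"
    from measurable_sets[OF comp[OF this(1)] this(2)]
    show "{x \<in> space ?N. x i \<in> A} \<in> sets ?N"
      by (simp add: vimage_def Int_def conj_commute)
  qed
  then show "sets (cube n) \<subseteq> sigma_sets (icube n) (lower_box n ` icube n)"
    using sub by simp
  show "sigma_sets (icube n) (lower_box n ` icube n) \<subseteq> sets (cube n)"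
    using sets.sigma_sets_subset[of "lower_box n ` icube n" "cube n"] lower_box_sets by auto
qed

lemma copula_measure_space:
  assumes "copula_measure n C \<mu>" shows "space \<mu> = icube n"
proof -
  have "sets \<mu> = sets (cube n)" using assms by (simp add: copula_measure_def)
  from sets_eq_imp_space_eq[OF this] show ?thesis by simp
qed

text \<open>Finite measures that agree on an intersection-stable generator coincide. Two boxes meet
  in the box whose corner is the coordinatewise minimum, and the cube is itself a box, so a constant
  sequence serves as the exhausting one.\<close>

lemma copula_measure_unique:
  assumes \<mu>: "copula_measure n C \<mu>" and \<nu>: "copula_measure n C \<nu>"
  shows "\<mu> = \<nu>"
proof (rule measure_eqI_generator_eq[where \<Omega>="icube n" and E="lower_box n ` icube n"
      and A="\<lambda>_. icube n"])
  interpret M: prob_space \<mu> using \<mu> by (simp add: copula_measure_def)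
  interpret N: prob_space \<nu> using \<nu> by (simp add: copula_measure_def)
  show "Int_stable (lower_box n ` icube n)"
  proof (rule Int_stableI_image)
    fix x y assume xy: "x \<in> icube n" "y \<in> icube n"
    have z: "(\<lambda>i\<in>{1..n}. min (x i) (y i)) \<in> icube n"
      using xy by (auto simp: icube_iff intro: min.coboundedI1)
    show "\<exists>z\<in>icube n. lower_box n x \<inter> lower_box n y = lower_box n z"
      by (rule bexI[OF _ z]) (auto simp: lower_box_eq[OF z] lower_box_eq[OF xy(1)] lower_box_eq[OF xy(2)])
  qed
  show "lower_box n ` icube n \<subseteq> Pow (icube n)"
    using lower_box_subset_icube by auto
  show "emeasure \<mu> X = emeasure \<nu> X" if "X \<in> lower_box n ` icube n" for X
    using that \<mu> \<nu> by (auto simp: M.emeasure_eq_measure N.emeasure_eq_measure copula_measure_def)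
  show "sets \<mu> = sigma_sets (icube n) (lower_box n ` icube n)"
    "sets \<nu> = sigma_sets (icube n) (lower_box n ` icube n)"
    using \<mu> \<nu> by (simp_all add: copula_measure_def sets_cube_eq)
  have one: "(\<lambda>i\<in>{1..n}. 1) \<in> icube n" by (auto simp: icube_def)
  have "icube n = lower_box n (\<lambda>i\<in>{1..n}. 1)"
    using icube_bounds(2) by (auto simp: lower_box_eq[OF one])
  then show "range (\<lambda>_::nat. icube n) \<subseteq> lower_box n ` icube n"
    using one by blast
  show "emeasure \<mu> (icube n) \<noteq> \<infinity>"
    by (simp add: M.emeasure_eq_measure)
qed auto

lemma mu_eqI: "copula_measure n C \<mu> \<Longrightarrow> mu n C = \<mu>"
  unfolding mu_def using copula_measure_unique by blast

lemma copula_measure_mu: "C \<in> Cop n \<Longrightarrow> copula_measure n C (mu n C)"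
  unfolding Cop_def using mu_eqI by fastforce

text \<open>The range condition in \<open>Cop\<close> is automatic because the values are
  probabilities. Later membership proofs therefore only exhibit a measure and check
  extensionality.\<close>

lemma copula_measure_in_Cop:
  assumes "copula_measure n C \<mu>" "C \<in> extensional (icube n)"
  shows "C \<in> Cop n"
proof -
  interpret prob_space \<mu> using assms(1) by (simp add: copula_measure_def)
  have "C x \<in> {0..1}" if "x \<in> icube n" for x
  proof -
    have "C x = measure \<mu> (lower_box n x)" using assms(1) that by (simp add: copula_measure_def)
    then show ?thesis by simp
  qed
  then show ?thesis using assms by (auto simp: Cop_def PiE_iff)
qed

lemma copula_eqI:
  assumes "A \<in> Cop n" "B \<in> Cop n" "\<And>x. x \<in> icube n \<Longrightarrow> A x = B x"
  shows "A = B"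
  using assms by (auto simp: Cop_def intro: PiE_ext)

section \<open>Transport of copulas along coordinate maps\<close>

lemma distr_unit_uniform_reflect: "distr unit_uniform unit_borel (\<lambda>t. 1 - t) = unit_uniform"
proof (rule measure_eqI)
  show "sets (distr unit_uniform unit_borel (\<lambda>t. 1 - t)) = sets unit_uniform"
    by (simp add: sets_unit_uniform)
  fix A assume "A \<in> sets (distr unit_uniform unit_borel (\<lambda>t. 1 - t))"
  then have A: "A \<in> sets unit_borel" by simp
  then have A': "A \<subseteq> {0..1}" "A \<in> sets borel"
    by (auto simp: sets_restrict_space_iff)
  have [measurable]: "(\<lambda>t::real. 1 - t) \<in> measurable unit_uniform unit_borel"
    by (rule measurable_restrict_space3) auto
  \<comment> \<open>With \<open>A\<close> its reflection lies in the unit interval too. The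
    restriction to the interval can then be dropped, and Lebesgue measure on the line is invariant
    under an affine map of slope -1.\<close>
  have sub: "(\<lambda>t. 1 - t) -` A \<subseteq> {0..1}"
    using A'(1) by force
  have "emeasure (distr unit_uniform unit_borel (\<lambda>t. 1 - t)) A =
      emeasure lborel ((\<lambda>t. 1 + (-1) * t) -` A \<inter> space lborel)"
    using A A' by (subst emeasure_distr) (auto simp: sub Int_absorb2 emeasure_restrict_space space_restrict_space)
  also have "\<dots> = emeasure (distr lborel borel (\<lambda>t. 1 + (-1) * t)) A"
    using A' by (subst emeasure_distr) auto
  also have "distr lborel borel (\<lambda>t. 1 + (-1) * t) = (lborel :: real measure)"
    using lborel_real_affine[of "-1" 1] by (simp add: density_1 one_ennreal_def[symmetric])
  also have "emeasure lborel A = emeasure unit_uniform A"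
    using A' by (simp add: emeasure_restrict_space)
  finally show "emeasure (distr unit_uniform unit_borel (\<lambda>t. 1 - t)) A = emeasure unit_uniform A" .
qed

text \<open>The index map \<open>f\<close> runs from new indices to old ones, against the direction
  of the point map. As the two dimensions may differ, marginals and symmetries of the cube belong to
  one family.\<close>

definition sel :: "nat \<Rightarrow> (nat \<Rightarrow> nat) \<Rightarrow> (nat \<Rightarrow> bool) \<Rightarrow> point \<Rightarrow> point" where
  "sel m f s x = (\<lambda>i\<in>{1..m}. if s i then 1 - x (f i) else x (f i))"

text \<open>The distribution function of the image of \<open>mu n C\<close> under
  \<open>sel m f s\<close>. Preimages are used so that it makes sense before the image is known to
  be a copula measure.\<close>

definition transport :: "nat \<Rightarrow> nat \<Rightarrow> (nat \<Rightarrow> nat) \<Rightarrow> (nat \<Rightarrow> bool) \<Rightarrow> copula \<Rightarrow> copula" where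
  "transport n m f s C = (\<lambda>y\<in>icube m. measure (mu n C) (sel m f s -` lower_box m y \<inter> icube n))"

lemma sel_in_icube:
  assumes "f \<in> {1..m} \<rightarrow> {1..n}" "x \<in> icube n"
  shows "sel m f s x \<in> icube m"
  using assms icube_bounds[OF assms(2)] by (auto simp: icube_iff sel_def Pi_iff)

lemma measurable_reflect: "(\<lambda>t::real. 1 - t) \<in> measurable unit_borel unit_borel"
  by (rule measurable_restrict_space3) auto

lemma measurable_sel:
  assumes "f \<in> {1..m} \<rightarrow> {1..n}"
  shows "sel m f s \<in> measurable (cube n) (cube m)"
  unfolding sel_def
proof (rule measurable_restrict)
  fix i assume "i \<in> {1..m}"
  then have "f i \<in> {1..n}" using assms by auto
  from measurable_component_singleton[OF this]
  have c: "(\<lambda>x. x (f i)) \<in> measurable (cube n) unit_borel" .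
  then show "(\<lambda>x. if s i then 1 - x (f i) else x (f i)) \<in> measurable (cube n) unit_borel"
    using measurable_compose[OF c measurable_reflect] by (cases "s i") auto
qed

text \<open>The point at issue is uniformity of the marginals: coordinate \<open>i\<close> of the
  image has the law of \<open>x (f i)\<close> or of \<open>1 - x (f i)\<close>, and the uniform law
  is invariant under reflection.\<close>

lemma copula_measure_transport:
  assumes C: "C \<in> Cop n" and f: "f \<in> {1..m} \<rightarrow> {1..n}"
  shows "copula_measure m (transport n m f s C) (distr (mu n C) (cube m) (sel m f s))"
proof -
  let ?\<mu> = "mu n C" and ?\<nu> = "distr (mu n C) (cube m) (sel m f s)"
  note \<mu> = copula_measure_mu[OF C]
  interpret prob_space ?\<mu> using \<mu> by (simp add: copula_measure_def)
  have sets_\<mu> [measurable_cong]: "sets ?\<mu> = sets (cube n)"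
    using \<mu> by (simp add: copula_measure_def)
  have sp: "space ?\<mu> = icube n" by (rule copula_measure_space[OF \<mu>])
  have sel: "sel m f s \<in> measurable ?\<mu> (cube m)"
    using measurable_sel[OF f] sets_\<mu> by (simp cong: measurable_cong_sets)
  have marg: "distr ?\<nu> unit_borel (\<lambda>x. x i) = unit_uniform" if i: "i \<in> {1..m}" for i
  proof -
    have fi: "f i \<in> {1..n}" using f i by auto
    have c: "(\<lambda>x. x (f i)) \<in> measurable ?\<mu> unit_borel"
      using measurable_component_singleton[OF fi, of "\<lambda>_. unit_borel"] sets_\<mu>
      by (simp cong: measurable_cong_sets)
    have d: "distr ?\<mu> unit_borel (\<lambda>x. x (f i)) = unit_uniform"
      using \<mu> fi by (auto simp: copula_measure_def)
    have "distr ?\<nu> unit_borel (\<lambda>x. x i) = distr ?\<mu> unit_borel (\<lambda>x. sel m f s x i)"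
      using distr_distr[OF measurable_component_singleton[OF i, of "\<lambda>_. unit_borel"] sel] by (simp add: o_def)
    also have "\<dots> = unit_uniform"
    proof (cases "s i")
      case True
      then have "distr ?\<mu> unit_borel (\<lambda>x. sel m f s x i) =
          distr (distr ?\<mu> unit_borel (\<lambda>x. x (f i))) unit_borel (\<lambda>t. 1 - t)"
        using i distr_distr[OF measurable_reflect c] by (simp add: o_def sel_def)
      then show ?thesis by (simp add: d distr_unit_uniform_reflect)
    next
      case False
      then show ?thesis using i d by (simp add: sel_def)
    qed
    finally show ?thesis .
  qed
  have "measure ?\<nu> (lower_box m y) = transport n m f s C y" if "y \<in> icube m" for y
    using that measure_distr[OF sel lower_box_sets[OF that]] by (simp add: transport_def sp)
  then show ?thesis
    using marg prob_space_distr[OF sel] by (simp add: copula_measure_def)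
qed

lemma transport_in_Cop:
  assumes "C \<in> Cop n" "f \<in> {1..m} \<rightarrow> {1..n}"
  shows "transport n m f s C \<in> Cop m"
  by (rule copula_measure_in_Cop[OF copula_measure_transport[OF assms]]) (simp add: transport_def)

lemma mu_transport:
  assumes "C \<in> Cop n" "f \<in> {1..m} \<rightarrow> {1..n}"
  shows "mu m (transport n m f s C) = distr (mu n C) (cube m) (sel m f s)"
  by (rule mu_eqI[OF copula_measure_transport[OF assms]])

lemma transport_cong:
  assumes "\<And>i. i \<in> {1..m} \<Longrightarrow> f i = g i" "\<And>i. i \<in> {1..m} \<Longrightarrow> s i = t i"
  shows "transport n m f s C = transport n m g t C"
proof -
  have "sel m f s = sel m g t" using assms by (auto simp: sel_def fun_eq_iff)
  then show ?thesis by (simp add: transport_def)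
qed

text \<open>Preimages under successive maps compose once \<open>mu_transport\<close> identifies the
  measure of the inner copula. Reflecting a coordinate twice undoes itself, so the marks combine by
  exclusive or, written \<open>\<noteq>\<close>.\<close>

lemma transport_transport:
  assumes C: "C \<in> Cop n" and f: "f \<in> {1..m} \<rightarrow> {1..n}" and g: "g \<in> {1..k} \<rightarrow> {1..m}"
  shows "transport m k g t (transport n m f s C) =
    transport n k (\<lambda>i. f (g i)) (\<lambda>i. t i \<noteq> s (g i)) C"
proof (rule copula_eqI)
  have fg: "(\<lambda>i. f (g i)) \<in> {1..k} \<rightarrow> {1..n}" using f g by auto
  show "transport m k g t (transport n m f s C) \<in> Cop k"
    by (intro transport_in_Cop C f g)
  show "transport n k (\<lambda>i. f (g i)) (\<lambda>i. t i \<noteq> s (g i)) C \<in> Cop k"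
    by (intro transport_in_Cop C fg)
  fix y assume y: "y \<in> icube k"
  note \<mu> = copula_measure_mu[OF C]
  have sets_\<mu>: "sets (mu n C) = sets (cube n)"
    using \<mu> by (simp add: copula_measure_def)
  have sp: "space (mu n C) = icube n" by (rule copula_measure_space[OF \<mu>])
  have sel: "sel m f s \<in> measurable (mu n C) (cube m)"
    using measurable_sel[OF f] sets_\<mu> by (simp cong: measurable_cong_sets)
  have set: "sel k g t -` lower_box k y \<inter> icube m \<in> sets (cube m)"
    using measurable_sets[OF measurable_sel[OF g] lower_box_sets[OF y]] by simp
  have comp: "sel k g t (sel m f s x) = sel k (\<lambda>i. f (g i)) (\<lambda>i. t i \<noteq> s (g i)) x" for x
    using g by (auto simp: sel_def fun_eq_iff Pi_iff)
  have "transport m k g t (transport n m f s C) y =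
      measure (mu n C) (sel m f s -` (sel k g t -` lower_box k y \<inter> icube m) \<inter> icube n)"
    using y by (simp add: transport_def[of m k] mu_transport[OF C f] measure_distr[OF sel set] sp)
  also have "sel m f s -` (sel k g t -` lower_box k y \<inter> icube m) \<inter> icube n =
      sel k (\<lambda>i. f (g i)) (\<lambda>i. t i \<noteq> s (g i)) -` lower_box k y \<inter> icube n"
    using sel_in_icube[OF f] by (auto simp: comp)
  finally show "transport m k g t (transport n m f s C) y =
      transport n k (\<lambda>i. f (g i)) (\<lambda>i. t i \<noteq> s (g i)) C y"
    using y by (simp add: transport_def[of n k])
qed

text \<open>Without reflections the preimage of the box with corner \<open>y\<close> is again a
  lower box, with corner \<open>z\<close>: coordinates hit by \<open>f\<close> inherit their bounds
  and the others carry the vacuous bound 1. This turns a measure of a preimage into a value of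
  \<open>C\<close> itself.\<close>

lemma transport_marginal:
  assumes C: "C \<in> Cop n" and f: "f \<in> {1..m} \<rightarrow> {1..n}"
    and y: "y \<in> icube m" and z: "z \<in> icube n"
    and zf: "\<And>i. i \<in> {1..m} \<Longrightarrow> z (f i) = y i"
    and z1: "\<And>j. j \<in> {1..n} \<Longrightarrow> j \<notin> f ` {1..m} \<Longrightarrow> z j = 1"
  shows "transport n m f (\<lambda>_. False) C y = C z"
proof -
  have "x \<in> lower_box n z \<longleftrightarrow> sel m f (\<lambda>_. False) x \<in> lower_box m y" if x: "x \<in> icube n" for x
  proof -
    have "x \<in> lower_box n z \<longleftrightarrow> (\<forall>j\<in>f ` {1..m}. x j \<le> z j)"
      unfolding lower_box_iff[OF x] using f z1 icube_bounds(2)[OF x] by (metis funcset_image subsetD)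
    also have "\<dots> \<longleftrightarrow> sel m f (\<lambda>_. False) x \<in> lower_box m y"
      unfolding lower_box_iff[OF sel_in_icube[OF f x]] by (simp add: zf sel_def)
    finally show ?thesis .
  qed
  then have "sel m f (\<lambda>_. False) -` lower_box m y \<inter> icube n = lower_box n z"
    using lower_box_subset_icube[OF z] by auto
  then show ?thesis
    using y z copula_measure_mu[OF C] by (simp add: transport_def copula_measure_def)
qed

section \<open>Permutations and reflections of the cube as transports\<close>

lemma pull_eq_transport:
  assumes C: "C \<in> Cop n" and f: "f \<in> {1..n} \<rightarrow> {1..n}"
    and \<xi>: "\<And>x. x \<in> icube n \<Longrightarrow> \<xi> x \<in> icube n"
    and inv1: "\<And>x. x \<in> icube n \<Longrightarrow> sel n f s (\<xi> x) = x"
    and inv2: "\<And>x. x \<in> icube n \<Longrightarrow> \<xi> (sel n f s x) = x"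
  shows "pull n \<xi> C = transport n n f s C"
proof -
  \<comment> \<open>\<open>pull\<close> measures forward images of boxes and
    \<open>transport\<close> measures preimages, so \<open>sel n f s\<close> has to be the inverse
    of \<open>\<xi>\<close> on the cube.\<close>
  have "\<xi> ` lower_box n x = sel n f s -` lower_box n x \<inter> icube n" if x: "x \<in> icube n" for x
  proof
    show "\<xi> ` lower_box n x \<subseteq> sel n f s -` lower_box n x \<inter> icube n"
      using lower_box_subset_icube[OF x] \<xi> inv1 by auto
    show "sel n f s -` lower_box n x \<inter> icube n \<subseteq> \<xi> ` lower_box n x"
      using inv2 by (auto simp: image_iff) metis
  qed
  then show ?thesis by (auto simp: pull_def transport_def)
qed

text \<open>The inverse of \<open>t\<close> enters because forward images under
  \<open>perm_map t\<close> are preimages under the inverse coordinate map.\<close>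

lemma pull_perm_map:
  assumes C: "C \<in> Cop n" and t: "t permutes {1..n}"
  shows "pull n (perm_map t) C = transport n n (inv t) (\<lambda>_. False) C"
proof (rule pull_eq_transport[OF C])
  have t': "inv t permutes {1..n}" by (rule permutes_inv[OF t])
  then show "inv t \<in> {1..n} \<rightarrow> {1..n}" by (simp add: permutes_imp_bij bij_betw_imp_funcset)
  fix x assume x: "x \<in> icube n"
  show p: "perm_map t x \<in> icube n"
    using x t permutes_in_image[OF t] by (auto simp: icube_iff perm_map_def extensional_def)
  show "sel n (inv t) (\<lambda>_. False) (perm_map t x) = x"
    using x permutes_inverses[OF t] by (auto simp: sel_def perm_map_def fun_eq_iff icube_iff extensional_def)
  show "perm_map t (sel n (inv t) (\<lambda>_. False) x) = x"
    using x permutes_inverses[OF t] permutes_in_image[OF t]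
    by (auto simp: sel_def perm_map_def fun_eq_iff icube_iff extensional_def)
qed

text \<open>Normal form for reflections: elementary reflections commute and are involutions, so a
  composition is determined by the set of coordinates flipped an odd number of times.\<close>

definition reflect_on :: "nat set \<Rightarrow> point \<Rightarrow> point" where
  "reflect_on S x = (\<lambda>i. if i \<in> S then 1 - x i else x i)"

lemma pull_reflect_on:
  assumes C: "C \<in> Cop n" and S: "S \<subseteq> {1..n}"
  shows "pull n (reflect_on S) C = transport n n (\<lambda>i. i) (\<lambda>i. i \<in> S) C"
proof (rule pull_eq_transport[OF C])
  fix x assume x: "x \<in> icube n"
  show "reflect_on S x \<in> icube n"
    using x S by (auto simp: icube_iff reflect_on_def extensional_def)
  show "sel n (\<lambda>i. i) (\<lambda>i. i \<in> S) (reflect_on S x) = x"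
    using x S by (auto simp: sel_def reflect_on_def fun_eq_iff icube_iff extensional_def)
  show "reflect_on S (sel n (\<lambda>i. i) (\<lambda>i. i \<in> S) x) = x"
    using x S by (auto simp: sel_def reflect_on_def fun_eq_iff icube_iff extensional_def)
qed auto

lemma elem_refl_eq_reflect_on: "elem_refl i = reflect_on {i}"
  by (auto simp: elem_refl_def reflect_on_def fun_eq_iff)

lemma full_refl_eq_reflect_on: "full_refl n = reflect_on {1..n}"
proof -
  have "foldr (\<circ>) (map elem_refl xs) id = reflect_on (set xs)" if "distinct xs" for xs
    using that
    by (induction xs) (auto simp: reflect_on_def elem_refl_def fun_eq_iff)
  from this[of "[1..<Suc n]"] show ?thesis
    by (simp add: full_refl_def atLeastLessThanSuc_atLeastAtMost del: upt_Suc)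
qed

lemma elem_refl_reflect_on:
  "elem_refl i \<circ> reflect_on S = reflect_on (if i \<in> S then S - {i} else insert i S)"
  by (auto simp: reflect_on_def elem_refl_def fun_eq_iff)

text \<open>Composing with an elementary reflection toggles one index of the flipped set. Toggling
  never leaves the subsets of the index range, and inserting indices one by one reaches all of
  them.\<close>

lemma reflections_eq: "reflections n = reflect_on ` Pow {1..n}"
proof
  show "reflections n \<subseteq> reflect_on ` Pow {1..n}"
  proof
    fix \<rho> assume "\<rho> \<in> reflections n"
    then show "\<rho> \<in> reflect_on ` Pow {1..n}"
    proof induction
      case 1
      have "id = reflect_on {}" by (auto simp: reflect_on_def)
      then show ?case by blast
    next
      case (2 \<rho> i)
      then obtain S where S: "\<rho> = reflect_on S" "S \<subseteq> {1..n}" by auto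
      then have "(if i \<in> S then S - {i} else insert i S) \<in> Pow {1..n}" using 2(2) by auto
      then show ?case by (simp only: S(1) elem_refl_reflect_on imageI)
    qed
  qed
  have "reflect_on S \<in> reflections n" if "finite S" "S \<subseteq> {1..n}" for S
    using that
  proof (induction S rule: finite_induct)
    case empty
    have "reflect_on {} = id" by (auto simp: reflect_on_def)
    then show ?case by (simp only: reflections.intros(1))
  next
    case (insert i S)
    then have "reflect_on (insert i S) = elem_refl i \<circ> reflect_on S"
      by (simp add: elem_refl_reflect_on)
    moreover have "elem_refl i \<circ> reflect_on S \<in> reflections n"
      using insert by (intro reflections.intros(2)) auto
    ultimately show ?case by (simp only:)
  qed
  then show "reflect_on ` Pow {1..n} \<subseteq> reflections n"
    using finite_subset[of _ "{1..n}"] by auto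
qed

lemma inj_reflect_on: "inj reflect_on"
proof (rule injI)
  fix S T assume "reflect_on S = reflect_on T"
  \<comment> \<open>At the origin \<open>reflect_on S\<close> yields the indicator function of
    \<open>S\<close>.\<close>
  from fun_cong[OF this, of "\<lambda>_. 0"] have "\<And>i. (i \<in> S) = (i \<in> T)"
    by (auto simp: reflect_on_def fun_eq_iff split: if_splits)
  then show "S = T" by auto
qed

section \<open>\<open>M_cop\<close> and \<open>Pi_cop\<close> are copulas\<close>

lemma measure_unit_uniform:
  assumes "0 \<le> c" "c \<le> 1"
  shows "measure unit_uniform {0..c} = c"
  using assms by (subst measure_restrict_space) auto

lemma sets_unit_borel_Icc: "0 \<le> c \<Longrightarrow> c \<le> 1 \<Longrightarrow> {0..c} \<in> sets unit_borel"
  by (auto simp: sets_restrict_space_iff)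

text \<open>The measure is the uniform law carried to the diagonal of the cube. A diagonal point
  lies in a box exactly when its common coordinate is at most the smallest corner coordinate;
  \<open>n \<ge> 1\<close> makes this minimum one of the coordinates.\<close>

lemma M_cop_in_Cop:
  assumes n: "n \<ge> 1"
  shows "M_cop n \<in> Cop n"
proof (rule copula_measure_in_Cop)
  let ?g = "\<lambda>t::real. \<lambda>i\<in>{1..n}. t"
  have g: "?g \<in> measurable unit_uniform (cube n)"
    by (rule measurable_restrict) (simp add: measurable_ident_sets sets_unit_uniform)
  interpret prob_space unit_uniform by (rule prob_space_unit_uniform)
  have "distr (distr unit_uniform (cube n) ?g) unit_borel (\<lambda>x. x i) = unit_uniform"
    if i: "i \<in> {1..n}" for i
  proof -
    have "distr (distr unit_uniform (cube n) ?g) unit_borel (\<lambda>x. x i) =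
        distr unit_uniform unit_borel (\<lambda>t. t)"
      using i distr_distr[OF measurable_component_singleton[OF i, of "\<lambda>_. unit_borel"] g]
      by (simp add: o_def)
    also have "\<dots> = unit_uniform"
      by (rule distr_id2) (simp add: sets_unit_uniform)
    finally show ?thesis .
  qed
  moreover have "measure (distr unit_uniform (cube n) ?g) (lower_box n x) = M_cop n x"
    if x: "x \<in> icube n" for x
  proof -
    have "Min (x ` {1..n}) \<in> x ` {1..n}" using n by (intro Min_in) auto
    then have c: "0 \<le> Min (x ` {1..n})" "Min (x ` {1..n}) \<le> 1"
      using icube_bounds[OF x] by auto
    have "?g -` lower_box n x \<inter> space unit_uniform = {0..Min (x ` {1..n})}"
      using n c(2) order_trans[OF _ icube_bounds(2)[OF x, of n]]
      by (auto simp: space_restrict_space lower_box_def PiE_iff)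
    then show ?thesis
      using x measure_distr[OF g lower_box_sets[OF x]] measure_unit_uniform[OF c]
      by (simp add: M_cop_def)
  qed
  ultimately show "copula_measure n (M_cop n) (distr unit_uniform (cube n) ?g)"
    using prob_space_distr[OF g] by (simp add: copula_measure_def)
qed (simp add: M_cop_def)

text \<open>The measure is the product of uniform laws, under which boxes factor into
  intervals.\<close>

lemma Pi_cop_in_Cop: "Pi_cop n \<in> Cop n"
proof (rule copula_measure_in_Cop)
  let ?P = "\<Pi>\<^sub>M i\<in>{1..n}. unit_uniform"
  interpret prob_space unit_uniform by (rule prob_space_unit_uniform)
  interpret product_prob_space "\<lambda>_. unit_uniform" "{1..n}" ..
  interpret finite_product_prob_space "\<lambda>_. unit_uniform" "{1..n}" by standard simp
  have "distr ?P unit_borel (\<lambda>x. x i) = unit_uniform" if i: "i \<in> {1..n}" for i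
  proof -
    have "distr ?P unit_borel (\<lambda>x. x i) = distr ?P unit_uniform (\<lambda>x. x i)"
      by (rule distr_cong) (simp_all add: sets_unit_uniform)
    also have "\<dots> = unit_uniform"
      by (rule distr_PiM_component[OF _ i]) (rule prob_space_unit_uniform)
    finally show ?thesis .
  qed
  moreover have "measure ?P (lower_box n x) = Pi_cop n x" if x: "x \<in> icube n" for x
  proof -
    have "measure ?P (\<Pi>\<^sub>E i\<in>{1..n}. {0..x i}) = (\<Prod>i\<in>{1..n}. measure unit_uniform {0..x i})"
      by (rule finite_measure_PiM_emb)
        (simp add: sets_unit_uniform sets_unit_borel_Icc icube_bounds[OF x])
    also have "\<dots> = (\<Prod>i\<in>{1..n}. x i)"
      by (rule prod.cong) (simp_all add: measure_unit_uniform icube_bounds[OF x])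
    finally show ?thesis using x by (simp add: lower_box_def Pi_cop_def)
  qed
  moreover have "sets ?P = sets (cube n)"
    by (rule sets_PiM_cong) (simp_all add: sets_unit_uniform)
  ultimately show "copula_measure n (Pi_cop n) ?P"
    using P.prob_space_axioms by (simp add: copula_measure_def)
qed (simp add: Pi_cop_def)

section \<open>Bivariate marginals at ordered pairs of indices\<close>

definition pair_index :: "nat \<Rightarrow> nat \<Rightarrow> nat \<Rightarrow> nat" where
  "pair_index a b i = (if i = 1 then a else b)"

abbreviation bimarginal :: "nat \<Rightarrow> nat \<Rightarrow> nat \<Rightarrow> copula \<Rightarrow> copula" where
  "bimarginal n a b \<equiv> transport n 2 (pair_index a b) (\<lambda>_. False)"

definition ordered_pairs :: "nat \<Rightarrow> (nat \<times> nat) set" where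
  "ordered_pairs n = {(a, b). a \<in> {1..n} \<and> b \<in> {1..n} \<and> a \<noteq> b}"

text \<open>The corner that constrains only the coordinates \<open>a\<close> and \<open>b\<close>;
  it supplies the \<open>z\<close> of \<open>transport_marginal\<close>.\<close>

definition fill_ones :: "nat \<Rightarrow> nat \<Rightarrow> nat \<Rightarrow> point \<Rightarrow> point" where
  "fill_ones n a b y = (\<lambda>j\<in>{1..n}. if j = a then y 1 else if j = b then y 2 else 1)"

lemma atLeastAtMost_1_2: "{1..2} = {1, 2::nat}"
  by auto

lemma finite_ordered_pairs: "finite (ordered_pairs n)"
  by (rule finite_subset[of _ "{1..n} \<times> {1..n}"]) (auto simp: ordered_pairs_def)

lemma card_ordered_pairs: "card (ordered_pairs n) = n * (n - 1)"
proof -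
  have "ordered_pairs n = (SIGMA a:{1..n}. {1..n} - {a})"
    by (auto simp: ordered_pairs_def)
  then show ?thesis by simp
qed

lemma pair_index_funcset:
  "(a, b) \<in> ordered_pairs n \<Longrightarrow> pair_index a b \<in> {1..2} \<rightarrow> {1..n}"
  by (auto simp: ordered_pairs_def pair_index_def)

lemma fill_ones_in_icube: "y \<in> icube 2 \<Longrightarrow> fill_ones n a b y \<in> icube n"
  by (auto simp: icube_iff fill_ones_def atLeastAtMost_1_2)

lemma bimarginal_in_Cop:
  "C \<in> Cop n \<Longrightarrow> (a, b) \<in> ordered_pairs n \<Longrightarrow> transport n 2 (pair_index a b) s C \<in> Cop 2"
  by (intro transport_in_Cop pair_index_funcset)

lemma bimarginal_apply:
  assumes "C \<in> Cop n" "(a, b) \<in> ordered_pairs n" "y \<in> icube 2"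
  shows "bimarginal n a b C y = C (fill_ones n a b y)"
  by (rule transport_marginal[OF assms(1) pair_index_funcset[OF assms(2)] assms(3) fill_ones_in_icube[OF assms(3)]])
    (use assms(2) in \<open>auto simp: fill_ones_def pair_index_def ordered_pairs_def atLeastAtMost_1_2\<close>)

text \<open>Padding with ones leaves a minimum over the unit interval unchanged, just as it leaves a
  product unchanged in the next lemma.\<close>

lemma bimarginal_M_cop:
  assumes "(a, b) \<in> ordered_pairs n"
  shows "bimarginal n a b (M_cop n) = M_cop 2"
proof -
  have n: "n \<ge> 1" using assms by (auto simp: ordered_pairs_def)
  note M = M_cop_in_Cop[OF n]
  show ?thesis
  proof (rule copula_eqI)
    show "bimarginal n a b (M_cop n) \<in> Cop 2" by (rule bimarginal_in_Cop[OF M assms])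
    show "M_cop 2 \<in> Cop 2" by (rule M_cop_in_Cop) simp
    fix y assume y: "y \<in> icube 2"
    have "Min (fill_ones n a b y ` {1..n}) = min (y 1) (y 2)"
    proof (rule Min_eqI)
      show "min (y 1) (y 2) \<le> z" if "z \<in> fill_ones n a b y ` {1..n}" for z
        using that icube_bounds(2)[OF y, of 1] by (auto simp: fill_ones_def min.coboundedI1)
      show "min (y 1) (y 2) \<in> fill_ones n a b y ` {1..n}"
        using assms by (auto simp: fill_ones_def ordered_pairs_def image_iff min_def)
    qed simp
    then show "bimarginal n a b (M_cop n) y = M_cop 2 y"
      unfolding bimarginal_apply[OF M assms y] using y fill_ones_in_icube[OF y]
      by (simp add: M_cop_def atLeastAtMost_1_2)
  qed
qed

lemma bimarginal_Pi_cop: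
  assumes "(a, b) \<in> ordered_pairs n"
  shows "bimarginal n a b (Pi_cop n) = Pi_cop 2"
proof (rule copula_eqI)
  show "bimarginal n a b (Pi_cop n) \<in> Cop 2" by (rule bimarginal_in_Cop[OF Pi_cop_in_Cop assms])
  show "Pi_cop 2 \<in> Cop 2" by (rule Pi_cop_in_Cop)
  fix y assume y: "y \<in> icube 2"
  have "(\<Prod>j\<in>{1..n}. fill_ones n a b y j) = (\<Prod>j\<in>{a, b}. fill_ones n a b y j)"
    by (rule prod.mono_neutral_right) (use assms in \<open>auto simp: fill_ones_def ordered_pairs_def\<close>)
  also have "\<dots> = y 1 * y 2"
    using assms by (auto simp: fill_ones_def ordered_pairs_def)
  finally show "bimarginal n a b (Pi_cop n) y = Pi_cop 2 y"
    unfolding bimarginal_apply[OF Pi_cop_in_Cop assms y] using y fill_ones_in_icube[OF y]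
    by (simp add: Pi_cop_def atLeastAtMost_1_2)
qed

text \<open>Positions are counted among the remaining indices, so with \<open>a < b\<close> the
  index \<open>a\<close> gets position 1 and \<open>b\<close> position 2. This matches the
  increasing order of the proper copula with \<open>pair_index\<close>.\<close>

lemma proper_copula_eq_bimarginal:
  assumes C: "C \<in> Cop n" and ab: "1 \<le> a" "a < b" "b \<le> n"
  shows "proper_copula n ({1..n} - {a, b}) C = bimarginal n a b C"
proof -
  let ?R = "{1..n} - {a, b}"
  have abP: "(a, b) \<in> ordered_pairs n" using ab by (auto simp: ordered_pairs_def)
  have "card ?R = n - 2" using ab by (subst card_Diff_subset) auto
  then have c: "n - card ?R = 2" using ab by simp
  have compl: "{1..n} - ?R = {a, b}" using ab by auto
  have "{j \<in> {a, b}. j \<le> a} = {a}" "{j \<in> {a, b}. j \<le> b} = {a, b}" using ab by auto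
  then have pos: "card {j \<in> {a, b}. j \<le> a} = 1" "card {j \<in> {a, b}. j \<le> b} = 2"
    using ab by simp_all
  have fill: "(\<lambda>i\<in>{1..n}. if i \<in> ?R then 1 else y (card {j \<in> {1..n} - ?R. j \<le> i})) = fill_ones n a b y" for y
    unfolding compl using pos by (auto simp: fill_ones_def fun_eq_iff)
  have ones: "(\<lambda>i. if i \<in> ?R then 1 else fill_ones n a b y i) = fill_ones n a b y" for y
    by (auto simp: fill_ones_def fun_eq_iff)
  show ?thesis
  proof (rule extensionalityI[of _ "icube 2"])
    show "proper_copula n ?R C \<in> extensional (icube 2)"
      unfolding proper_copula_def c by simp
    show "bimarginal n a b C \<in> extensional (icube 2)" by (simp add: transport_def)
    fix y assume y: "y \<in> icube 2"
    show "proper_copula n ?R C y = bimarginal n a b C y"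
      unfolding proper_copula_def c fill marginal_def using y fill_ones_in_icube[OF y]
      by (simp only: restrict_apply if_True ones bimarginal_apply[OF C abP y])
  qed
qed

lemma bimarginal_1_2: "C \<in> Cop 2 \<Longrightarrow> bimarginal 2 1 2 C = C"
proof (rule copula_eqI)
  assume C: "C \<in> Cop 2"
  have P: "(1, 2) \<in> ordered_pairs 2" by (auto simp: ordered_pairs_def)
  show "bimarginal 2 1 2 C \<in> Cop 2" by (rule bimarginal_in_Cop[OF C P])
  fix y assume y: "y \<in> icube 2"
  have "fill_ones 2 1 2 y = y"
    using y by (auto simp: fill_ones_def fun_eq_iff icube_def PiE_def extensional_def atLeastAtMost_1_2)
  then show "bimarginal 2 1 2 C y = C y" using bimarginal_apply[OF C P y] by simp
qed

lemma pull_permutation_bimarginal: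
  assumes C: "C \<in> Cop n" and t: "t permutes {1..n}" and ab: "(a, b) \<in> ordered_pairs n"
  shows "bimarginal n a b (pull n (perm_map t) C) = bimarginal n (inv t a) (inv t b) C"
proof -
  have t': "inv t \<in> {1..n} \<rightarrow> {1..n}"
    using permutes_inv[OF t] by (simp add: permutes_imp_bij bij_betw_imp_funcset)
  have "bimarginal n a b (pull n (perm_map t) C) =
      transport n 2 (\<lambda>i. inv t (pair_index a b i)) (\<lambda>i. False \<noteq> False) C"
    unfolding pull_perm_map[OF C t] by (rule transport_transport[OF C t' pair_index_funcset[OF ab]])
  also have "\<dots> = bimarginal n (inv t a) (inv t b) C"
    by (rule transport_cong) (auto simp: pair_index_def)
  finally show ?thesis .
qed

text \<open>Of the whole reflection only the marks at \<open>a\<close> and \<open>b\<close> survive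
  in the marginal, which reduces sign questions in dimension \<open>n\<close> to reflections of the
  square.\<close>

lemma pull_reflect_on_bimarginal:
  assumes C: "C \<in> Cop n" and S: "S \<subseteq> {1..n}" and ab: "(a, b) \<in> ordered_pairs n"
  shows "bimarginal n a b (pull n (reflect_on S) C) =
    transport n 2 (pair_index a b) (\<lambda>i. pair_index a b i \<in> S) C"
  unfolding pull_reflect_on[OF C S]
  by (subst transport_transport[OF C _ pair_index_funcset[OF ab]]) (auto intro!: transport_cong)

section \<open>Sums over index pairs, sign rules, and the average formula\<close>

lemma sum_ordered_pairs:
  fixes g :: "nat \<Rightarrow> nat \<Rightarrow> real"
  assumes "\<And>a b. (a, b) \<in> ordered_pairs n \<Longrightarrow> g b a = g a b"
  shows "(\<Sum>(a, b)\<in>ordered_pairs n. g a b) = 2 * (\<Sum>(a, b) | 1 \<le> a \<and> a < b \<and> b \<le> n. g a b)"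
proof -
  let ?L = "{(a, b). 1 \<le> a \<and> a < b \<and> b \<le> n}" and ?U = "{(a, b). 1 \<le> b \<and> b < a \<and> a \<le> n}"
  have P: "ordered_pairs n = ?L \<union> ?U" by (auto simp: ordered_pairs_def)
  have fin: "finite ?L" "finite ?U" using finite_ordered_pairs[of n] unfolding P by simp_all
  have "(\<Sum>(a, b)\<in>?U. g a b) = (\<Sum>(a, b)\<in>?L. g a b)"
    by (rule sum.reindex_bij_witness[of _ prod.swap prod.swap])
      (auto simp: prod.swap_def intro!: assms simp: ordered_pairs_def)
  moreover have "(\<Sum>(a, b)\<in>ordered_pairs n. g a b) = (\<Sum>(a, b)\<in>?L. g a b) + (\<Sum>(a, b)\<in>?U. g a b)"
    unfolding P by (rule sum.union_disjoint[OF fin]) auto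
  ultimately show ?thesis by simp
qed

text \<open>Each \<open>R\<close> is encoded by its complement, and a two-element complement is
  recovered from its minimum and maximum.\<close>

lemma sum_complement_pairs:
  fixes g :: "nat set \<Rightarrow> real"
  assumes "n \<ge> 2"
  shows "(\<Sum>R | R \<subseteq> {1..n} \<and> card R = n - 2. g R) =
    (\<Sum>(a, b) | 1 \<le> a \<and> a < b \<and> b \<le> n. g ({1..n} - {a, b}))"
proof (rule sum.reindex_bij_witness[of _ "\<lambda>(a, b). {1..n} - {a, b}"
      "\<lambda>R. (Min ({1..n} - R), Max ({1..n} - R))"], goal_cases)
  have *: "\<exists>a b. 1 \<le> a \<and> a < b \<and> b \<le> n \<and> {1..n} - R = {a, b}" if "R \<subseteq> {1..n}" "card R = n - 2" for R
  proof -
    have "card ({1..n} - R) = 2"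
      using that assms by (subst card_Diff_subset) (auto intro: finite_subset)
    then obtain x y where xy: "{1..n} - R = {x, y}" "x \<noteq> y" by (auto simp: card_2_iff)
    then have "x \<in> {1..n}" "y \<in> {1..n}" by blast+
    with xy show ?thesis by (cases "x < y") (force simp: insert_commute)+
  qed
  {
    case (1 R)
    then obtain a b where "1 \<le> a" "a < b" "b \<le> n" "{1..n} - R = {a, b}" using * by blast
    then show ?case using 1 by auto
  next
    case (2 R)
    then obtain a b where "1 \<le> a" "a < b" "b \<le> n" "{1..n} - R = {a, b}" using * by blast
    then show ?case by auto
  next
    case (3 p)
    then obtain a b where ab: "p = (a, b)" "1 \<le> a" "a < b" "b \<le> n" by auto
    then have "{1..n} - ({1..n} - {a, b}) = {a, b}" by auto
    with ab show ?case by auto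
  next
    case (4 p)
    then obtain a b where ab: "p = (a, b)" "1 \<le> a" "a < b" "b \<le> n" by auto
    then have "card ({1..n} - {a, b}) = n - 2" by (subst card_Diff_subset) auto
    with ab show ?case by auto
  next
    case (5 R)
    then obtain a b where ab: "1 \<le> a" "a < b" "b \<le> n" "{1..n} - R = {a, b}" using * by blast
    have "R \<subseteq> {1..n}" using 5 by simp
    then have R: "{1..n} - {a, b} = R" unfolding ab(4)[symmetric] by (rule double_diff) simp
    have "Min ({1..n} - R) = a" "Max ({1..n} - R) = b" unfolding ab(4) using ab by auto
    then show ?case by (simp only: prod.case R)
  }
qed

text \<open>This makes all ordered pairs admissible although proper copulas list indices in
  increasing order: exchanging the two variables is the nontrivial permutation of the
  square.\<close>

lemma scarsini_swap:
  assumes \<kappa>: "scarsini_measure \<kappa>\<^sub>2" and C: "C \<in> Cop n" and ab: "(a, b) \<in> ordered_pairs n"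
  shows "\<kappa>\<^sub>2 (bimarginal n b a C) = \<kappa>\<^sub>2 (bimarginal n a b C)"
proof -
  let ?t = "Transposition.transpose 1 (2::nat)"
  have t: "?t permutes {1..2}" by (rule permutes_swap_id) auto
  have P: "(1, 2) \<in> ordered_pairs 2" by (auto simp: ordered_pairs_def)
  have bi: "bimarginal n a b C \<in> Cop 2" by (rule bimarginal_in_Cop[OF C ab])
  have t': "?t \<in> {1..2} \<rightarrow> {1..2}"
    using t by (simp add: permutes_imp_bij bij_betw_imp_funcset)
  have "pull 2 (perm_map ?t) (bimarginal n a b C) = transport n 2 (\<lambda>i. pair_index a b (?t i)) (\<lambda>i. False \<noteq> False) C"
    unfolding pull_perm_map[OF bi t] using transport_transport[OF C pair_index_funcset[OF ab] t'] by simp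
  also have "\<dots> = bimarginal n b a C"
    by (rule transport_cong) (auto simp: pair_index_def Transposition.transpose_def)
  finally have "pull 2 (perm_map ?t) (bimarginal n a b C) = bimarginal n b a C" .
  moreover have "perm_map ?t \<in> permutations_of_cube 2"
    using t by (auto simp: permutations_of_cube_def)
  ultimately show ?thesis using \<kappa> bi unfolding scarsini_measure_def by metis
qed

text \<open>The marks \<open>s\<close> and \<open>t\<close> differ at position \<open>k\<close>
  alone, so the two transports differ by one elementary reflection of the square. All later sign
  rules come from this.\<close>

lemma scarsini_flip:
  assumes \<kappa>: "scarsini_measure \<kappa>\<^sub>2" and C: "C \<in> Cop n" and ab: "(a, b) \<in> ordered_pairs n"
    and k: "k \<in> {1, 2}" and flip: "\<And>i. i \<in> {1, 2} \<Longrightarrow> s i = (t i \<noteq> (i = k))"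
  shows "\<kappa>\<^sub>2 (transport n 2 (pair_index a b) s C) = - \<kappa>\<^sub>2 (transport n 2 (pair_index a b) t C)"
proof -
  let ?T = "transport n 2 (pair_index a b) t C"
  have T: "?T \<in> Cop 2" by (rule bimarginal_in_Cop[OF C ab])
  have k': "{k} \<subseteq> {1..2}" using k by auto
  have "pull 2 (elem_refl k) ?T = transport n 2 (pair_index a b) (\<lambda>i. (i \<in> {k}) \<noteq> t i) C"
    unfolding elem_refl_eq_reflect_on pull_reflect_on[OF T k']
    by (rule transport_transport[OF C pair_index_funcset[OF ab]]) auto
  also have "\<dots> = transport n 2 (pair_index a b) s C"
    by (rule transport_cong) (auto simp: flip atLeastAtMost_1_2)
  finally have "pull 2 (elem_refl k) ?T = transport n 2 (pair_index a b) s C" .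
  moreover have "\<kappa>\<^sub>2 (pull 2 (elem_refl k) ?T) = - \<kappa>\<^sub>2 ?T"
    using \<kappa> T k unfolding scarsini_measure_def by auto
  ultimately show ?thesis by simp
qed

text \<open>Working form of the hypotheses in every dimension from 2 on. Ordered pairs count each
  complement twice, which absorbs the 2 in the binomial coefficient; unlike the increasing pairs,
  they are preserved by every permutation of the indices.\<close>

lemma concordance_average:
  assumes \<kappa>: "scarsini_measure \<kappa>\<^sub>2"
    and \<kappa>2: "\<And>C. C \<in> Cop 2 \<Longrightarrow> \<kappa> 2 C = \<kappa>\<^sub>2 C"
    and \<kappa>p: "\<And>p C. \<lbrakk>p \<ge> 1; C \<in> Cop (2 + p)\<rbrakk> \<Longrightarrow>
           \<kappa> (2 + p) C =
             1 / real ((2 + p) choose 2) *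
             (\<Sum>R | R \<subseteq> {1..2 + p} \<and> card R = p. \<kappa>\<^sub>2 (proper_copula (2 + p) R C))"
    and n: "n \<ge> 2" and C: "C \<in> Cop n"
  shows "\<kappa> n C = (\<Sum>(a, b)\<in>ordered_pairs n. \<kappa>\<^sub>2 (bimarginal n a b C)) / (real n * (real n - 1))"
proof -
  let ?L = "{(a, b). 1 \<le> a \<and> a < b \<and> b \<le> n}"
  have ch: "real (n choose 2) = real n * (real n - 1) / 2"
    using n by (simp add: choose_two real_of_nat_div of_nat_diff)
  have "\<kappa> n C = 1 / real (n choose 2) * (\<Sum>(a, b)\<in>?L. \<kappa>\<^sub>2 (bimarginal n a b C))"
  proof (cases "n = 2")
    case True
    \<comment> \<open>In dimension 2 the only marginal is the copula itself, so the prescribed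
      \<open>\<kappa> 2\<close> fits the general formula.\<close>
    have "?L = {(1, 2)}" using True by auto
    then show ?thesis using C True by (simp add: \<kappa>2 bimarginal_1_2)
  next
    case False
    define p where "p = n - 2"
    have p: "p \<ge> 1" "n = 2 + p" using False n by (auto simp: p_def)
    have "\<kappa> n C = 1 / real (n choose 2) *
        (\<Sum>R | R \<subseteq> {1..n} \<and> card R = n - 2. \<kappa>\<^sub>2 (proper_copula n R C))"
      using \<kappa>p[of p C] p C by simp
    also have "(\<Sum>R | R \<subseteq> {1..n} \<and> card R = n - 2. \<kappa>\<^sub>2 (proper_copula n R C)) =
        (\<Sum>(a, b)\<in>?L. \<kappa>\<^sub>2 (proper_copula n ({1..n} - {a, b}) C))"
      by (rule sum_complement_pairs[OF n])
    also have "\<dots> = (\<Sum>(a, b)\<in>?L. \<kappa>\<^sub>2 (bimarginal n a b C))"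
      by (rule sum.cong) (auto simp: proper_copula_eq_bimarginal[OF C])
    finally show ?thesis .
  qed
  moreover have "(\<Sum>(a, b)\<in>ordered_pairs n. \<kappa>\<^sub>2 (bimarginal n a b C)) =
      2 * (\<Sum>(a, b)\<in>?L. \<kappa>\<^sub>2 (bimarginal n a b C))"
    by (rule sum_ordered_pairs) (rule scarsini_swap[OF \<kappa> C])
  ultimately show ?thesis by (simp add: ch)
qed

section \<open>Order, limits, reflection sums and the transition step on bivariate marginals\<close>

lemma conc_le_bimarginal:
  assumes A: "A \<in> Cop n" and B: "B \<in> Cop n" and le: "conc_le n A B" and ab: "(a, b) \<in> ordered_pairs n"
  shows "conc_le 2 (bimarginal n a b A) (bimarginal n a b B)"
proof -
  have id: "(\<lambda>i. i) \<in> {1..n} \<rightarrow> {1..n}" by auto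
  \<comment> \<open>Taking a bivariate marginal commutes with reflecting all coordinates. Both
    inequalities of \<open>conc_le\<close> then become the given ones at the points
    \<open>fill_ones n a b y\<close>.\<close>
  have pull_bi: "pull 2 (full_refl 2) (bimarginal n a b C) = bimarginal n a b (pull n (full_refl n) C)"
    if C: "C \<in> Cop n" for C
  proof -
    have "pull 2 (full_refl 2) (bimarginal n a b C) =
        transport n 2 (pair_index a b) (\<lambda>i. (i \<in> {1..2}) \<noteq> False) C"
      unfolding full_refl_eq_reflect_on pull_reflect_on[OF bimarginal_in_Cop[OF C ab] order_refl]
      by (rule transport_transport[OF C pair_index_funcset[OF ab]]) auto
    also have "\<dots> = bimarginal n a b (pull n (full_refl n) C)"
      unfolding full_refl_eq_reflect_on pull_reflect_on_bimarginal[OF C order_refl ab]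
      by (rule transport_cong) (use pair_index_funcset[OF ab] in auto)
    finally show ?thesis .
  qed
  have pull_Cop: "pull n (full_refl n) C \<in> Cop n" if "C \<in> Cop n" for C
    unfolding full_refl_eq_reflect_on pull_reflect_on[OF that order_refl]
    by (rule transport_in_Cop[OF that id])
  show ?thesis
    unfolding conc_le_def
    using le fill_ones_in_icube
    by (simp add: conc_le_def pull_bi A B pull_Cop bimarginal_apply[OF _ ab])
qed

text \<open>Values of a bivariate marginal are values of the copula at padded points, so a uniform
  bound for the copulas is one for the marginals.\<close>

lemma uniform_limit_bimarginal:
  assumes "\<And>m. F m \<in> Cop n" "C \<in> Cop n" "uniform_limit (icube n) F C sequentially"
    and ab: "(a, b) \<in> ordered_pairs n"
  shows "uniform_limit (icube 2) (\<lambda>m. bimarginal n a b (F m)) (bimarginal n a b C) sequentially"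
  unfolding uniform_limit_iff
proof (intro allI impI)
  fix e :: real assume "e > 0"
  with assms(3) have "\<forall>\<^sub>F m in sequentially. \<forall>x\<in>icube n. dist (F m x) (C x) < e"
    unfolding uniform_limit_iff by blast
  then show "\<forall>\<^sub>F m in sequentially. \<forall>x\<in>icube 2. dist (bimarginal n a b (F m) x) (bimarginal n a b C x) < e"
    by (rule eventually_mono) (simp add: bimarginal_apply[OF _ ab] assms(1,2) fill_ones_in_icube)
qed

text \<open>By \<open>CE\<close>, dropping the first coordinate of \<open>E\<close> gives
  \<open>C\<close>, so \<open>C\<close> is the transport of \<open>E\<close> along
  \<open>Suc\<close>; composition of transports does the rest.\<close>

lemma bimarginal_Suc:
  assumes C: "C \<in> Cop n" and E: "E \<in> Cop (n + 1)" and CE: "\<And>x. x \<in> icube n \<Longrightarrow> C x = E (cons_one n x)"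
    and ab: "(a, b) \<in> ordered_pairs n"
  shows "bimarginal (n + 1) (Suc a) (Suc b) E = bimarginal n a b C"
proof -
  have Suc: "Suc \<in> {1..n} \<rightarrow> {1..n + 1}" by auto
  have "C = transport (n + 1) n Suc (\<lambda>_. False) E"
  proof (rule copula_eqI[OF C transport_in_Cop[OF E Suc]])
    fix x assume x: "x \<in> icube n"
    have "x (i - 1) \<in> {0..1}" if "i \<in> {1..n + 1}" "i \<noteq> 1" for i
    proof -
      have "i - 1 \<in> {1..n}" using that by auto
      from icube_bounds[OF x this] show ?thesis by simp
    qed
    then have "cons_one n x \<in> icube (n + 1)"
      by (auto simp: cons_one_def icube_def)
    then have "transport (n + 1) n Suc (\<lambda>_. False) E x = E (cons_one n x)"
      by (rule transport_marginal[OF E Suc x]) (auto simp: cons_one_def image_Suc_atLeastAtMost)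
    then show "C x = transport (n + 1) n Suc (\<lambda>_. False) E x" using CE x by simp
  qed
  then have "bimarginal n a b C =
      transport (n + 1) 2 (\<lambda>i. Suc (pair_index a b i)) (\<lambda>i. False \<noteq> False) E"
    using transport_transport[OF E Suc pair_index_funcset[OF ab]] by simp
  also have "\<dots> = bimarginal (n + 1) (Suc a) (Suc b) E"
    by (rule transport_cong) (auto simp: pair_index_def)
  finally show ?thesis ..
qed

text \<open>Toggling membership of \<open>a\<close> in the flipped set is an involution that negates
  every summand, so the sum equals its own negative.\<close>

lemma sum_reflections_eq_0:
  assumes \<kappa>: "scarsini_measure \<kappa>\<^sub>2" and C: "C \<in> Cop n" and ab: "(a, b) \<in> ordered_pairs n"
  shows "(\<Sum>\<rho>\<in>reflections n. \<kappa>\<^sub>2 (bimarginal n a b (pull n \<rho> C))) = 0"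
proof -
  let ?g = "\<lambda>S. \<kappa>\<^sub>2 (transport n 2 (pair_index a b) (\<lambda>i. pair_index a b i \<in> S) C)"
  let ?tog = "\<lambda>S. if a \<in> S then S - {a} else insert a S"
  have a: "a \<in> {1..n}" "a \<noteq> b" using ab by (auto simp: ordered_pairs_def)
  have tog: "?tog (?tog S) = S" "?tog S \<in> Pow {1..n}" if "S \<in> Pow {1..n}" for S
    using a(1) that by (auto simp: insert_absorb)
  have "(\<Sum>\<rho>\<in>reflections n. \<kappa>\<^sub>2 (bimarginal n a b (pull n \<rho> C))) = (\<Sum>S\<in>Pow {1..n}. ?g S)"
    unfolding reflections_eq sum.reindex[OF inj_on_subset[OF inj_reflect_on subset_UNIV]] o_def
    by (rule sum.cong) (simp_all add: pull_reflect_on_bimarginal[OF C _ ab])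
  moreover have "(\<Sum>S\<in>Pow {1..n}. ?g S) = (\<Sum>S\<in>Pow {1..n}. - ?g S)"
  proof (rule sum.reindex_bij_witness[of _ ?tog ?tog])
    fix S assume S: "S \<in> Pow {1..n}"
    \<comment> \<open>Since \<open>a \<noteq> b\<close>, the toggle changes the mark at position 1
      only.\<close>
    have "?g (?tog S) = - ?g S"
      by (rule scarsini_flip[OF \<kappa> C ab, where k = 1]) (use a in \<open>auto simp: pair_index_def\<close>)
    then show "- ?g (?tog S) = ?g S" by (simp only: minus_minus)
    show "?tog (?tog S) = S" "?tog S \<in> Pow {1..n}" using S by (rule tog)+
    show "?tog (?tog S) = S" "?tog S \<in> Pow {1..n}" using S by (rule tog)+
  qed
  ultimately show ?thesis unfolding sum_negf by linarith
qed

lemma sum_transition: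
  assumes \<kappa>: "scarsini_measure \<kappa>\<^sub>2" and C: "C \<in> Cop n" and E: "E \<in> Cop (n + 1)"
    and CE: "\<And>x. x \<in> icube n \<Longrightarrow> C x = E (cons_one n x)"
  shows "(\<Sum>(a, b)\<in>ordered_pairs (n + 1). \<kappa>\<^sub>2 (bimarginal (n + 1) a b E)) +
      (\<Sum>(a, b)\<in>ordered_pairs (n + 1). \<kappa>\<^sub>2 (bimarginal (n + 1) a b (pull (n + 1) (elem_refl 1) E))) =
    2 * (\<Sum>(a, b)\<in>ordered_pairs n. \<kappa>\<^sub>2 (bimarginal n a b C))"
proof -
  let ?n = "n + 1" and ?E' = "pull (n + 1) (elem_refl 1) E"
  let ?D = "{(a, b) \<in> ordered_pairs ?n. a \<noteq> 1 \<and> b \<noteq> 1}"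
  have one: "{1} \<subseteq> {1..?n}" by auto
  have E': "bimarginal ?n a b ?E' = transport ?n 2 (pair_index a b) (\<lambda>i. pair_index a b i \<in> {1}) E"
    if "(a, b) \<in> ordered_pairs ?n" for a b
    unfolding elem_refl_eq_reflect_on by (rule pull_reflect_on_bimarginal[OF E one that])
  have cancel: "\<kappa>\<^sub>2 (bimarginal ?n a b E) + \<kappa>\<^sub>2 (bimarginal ?n a b ?E') = 0"
    if ab: "(a, b) \<in> ordered_pairs ?n" and "a = 1 \<or> b = 1" for a b
  proof -
    \<comment> \<open>Here \<open>k\<close> is the position at which index 1 sits in the pair;
      \<open>a \<noteq> b\<close> ensures that there is only one.\<close>
    have "\<kappa>\<^sub>2 (bimarginal ?n a b ?E') = - \<kappa>\<^sub>2 (bimarginal ?n a b E)"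
      unfolding E'[OF ab]
      by (rule scarsini_flip[OF \<kappa> E ab, where k = "if a = 1 then 1 else 2"])
        (use that in \<open>auto simp: pair_index_def ordered_pairs_def\<close>)
    then show ?thesis by simp
  qed
  have double: "\<kappa>\<^sub>2 (bimarginal ?n a b E) + \<kappa>\<^sub>2 (bimarginal ?n a b ?E') = 2 * \<kappa>\<^sub>2 (bimarginal ?n a b E)"
    if "(a, b) \<in> ordered_pairs ?n" "a \<noteq> 1" "b \<noteq> 1" for a b
  proof -
    have "bimarginal ?n a b ?E' = bimarginal ?n a b E"
      unfolding E'[OF that(1)] by (rule transport_cong) (use that in \<open>auto simp: pair_index_def\<close>)
    then show ?thesis by simp
  qed
  have shift: "bimarginal n (a - 1) (b - 1) C = bimarginal ?n a b E"
    if "1 \<le> a" "a \<le> ?n" "1 \<le> b" "b \<le> ?n" "a \<noteq> b" "a \<noteq> 1" "b \<noteq> 1" for a b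
  proof -
    have "(a - 1, b - 1) \<in> ordered_pairs n" using that by (auto simp: ordered_pairs_def)
    from bimarginal_Suc[OF C E CE this] show ?thesis using that by simp
  qed
  have "(\<Sum>(a, b)\<in>ordered_pairs ?n. \<kappa>\<^sub>2 (bimarginal ?n a b E)) +
      (\<Sum>(a, b)\<in>ordered_pairs ?n. \<kappa>\<^sub>2 (bimarginal ?n a b ?E')) =
    (\<Sum>(a, b)\<in>ordered_pairs ?n. \<kappa>\<^sub>2 (bimarginal ?n a b E) + \<kappa>\<^sub>2 (bimarginal ?n a b ?E'))"
    by (simp add: sum.distrib[symmetric] case_prod_beta)
  also have "\<dots> = (\<Sum>(a, b)\<in>?D. \<kappa>\<^sub>2 (bimarginal ?n a b E) + \<kappa>\<^sub>2 (bimarginal ?n a b ?E'))"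
    by (rule sum.mono_neutral_right[OF finite_ordered_pairs]) (auto simp: cancel)
  also have "\<dots> = (\<Sum>(a, b)\<in>?D. 2 * \<kappa>\<^sub>2 (bimarginal ?n a b E))"
    by (rule sum.cong) (auto simp: double)
  \<comment> \<open>Pairs avoiding index 1 are the pairs for \<open>C\<close> shifted by one. Their
    entries are at least 2, so the truncated subtraction loses nothing.\<close>
  also have "\<dots> = (\<Sum>(a, b)\<in>ordered_pairs n. 2 * \<kappa>\<^sub>2 (bimarginal n a b C))"
    by (rule sum.reindex_bij_witness[of _ "\<lambda>(a, b). (Suc a, Suc b)" "\<lambda>(a, b). (a - 1, b - 1)"])
      (auto simp: ordered_pairs_def shift)
  also have "\<dots> = 2 * (\<Sum>(a, b)\<in>ordered_pairs n. \<kappa>\<^sub>2 (bimarginal n a b C))"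
    by (simp add: sum_distrib_left case_prod_beta)
  finally show ?thesis .
qed

section \<open>Verification of the axioms\<close>

theorem theorem3:
  fixes \<kappa>\<^sub>2 :: "copula \<Rightarrow> real"
    and \<kappa> :: "nat \<Rightarrow> copula \<Rightarrow> real"
    and r :: "nat \<Rightarrow> real"
  assumes "scarsini_measure \<kappa>\<^sub>2"
    and "\<And>C. C \<in> Cop 2 \<Longrightarrow> \<kappa> 2 C = \<kappa>\<^sub>2 C"
    and "\<And>p C. \<lbrakk>p \<ge> 1; C \<in> Cop (2 + p)\<rbrakk> \<Longrightarrow>
           \<kappa> (2 + p) C =
             1 / real ((2 + p) choose 2) *
             (\<Sum>R | R \<subseteq> {1..2 + p} \<and> card R = p. \<kappa>\<^sub>2 (proper_copula (2 + p) R C))"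
    and "\<And>p. p \<ge> 1 \<Longrightarrow> r (1 + p) = 2 * real p / (2 + real p)"
  shows "measure_of_concordance \<kappa> r"
  unfolding measure_of_concordance_def
proof (intro allI impI conjI ballI)
  fix n :: nat assume n: "2 \<le> n"
  then have n1: "n \<ge> 1" by simp
  note \<kappa> = assms(1)
  let ?P = "ordered_pairs n" and ?c = "real n * (real n - 1)"
  have c: "?c > 0" using n by simp
  have card: "real (card ?P) = ?c"
    using n by (simp add: card_ordered_pairs of_nat_diff)
  have avg: "\<kappa> m C = (\<Sum>(a, b)\<in>ordered_pairs m. \<kappa>\<^sub>2 (bimarginal m a b C)) / (real m * (real m - 1))"
    if "m \<ge> 2" "C \<in> Cop m" for m C
    by (rule concordance_average[OF \<kappa> assms(2) assms(3) that])
  have pull_refl_Cop: "pull m (reflect_on S) C \<in> Cop m" if "C \<in> Cop m" "S \<subseteq> {1..m}" for m S C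
    unfolding pull_reflect_on[OF that] by (rule transport_in_Cop[OF that(1)]) auto
  show "\<kappa> n (M_cop n) = 1"
  proof -
    have "(\<Sum>(a, b)\<in>?P. \<kappa>\<^sub>2 (bimarginal n a b (M_cop n))) = (\<Sum>(a, b)\<in>?P. 1)"
      using \<kappa> by (intro sum.cong) (auto simp: bimarginal_M_cop scarsini_measure_def)
    also have "\<dots> = ?c" using card by (simp add: case_prod_beta)
    finally show ?thesis using n avg[OF n M_cop_in_Cop[OF n1]] by simp
  qed
  show "\<kappa> n (Pi_cop n) = 0"
  proof -
    have "(\<Sum>(a, b)\<in>?P. \<kappa>\<^sub>2 (bimarginal n a b (Pi_cop n))) = 0"
      using \<kappa> by (intro sum.neutral) (auto simp: bimarginal_Pi_cop scarsini_measure_def)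
    then show ?thesis using avg[OF n Pi_cop_in_Cop] by simp
  qed
  show "\<kappa> n A \<le> \<kappa> n B" if A: "A \<in> Cop n" and B: "B \<in> Cop n" and le: "conc_le n A B" for A B
  proof -
    have "(\<Sum>(a, b)\<in>?P. \<kappa>\<^sub>2 (bimarginal n a b A)) \<le> (\<Sum>(a, b)\<in>?P. \<kappa>\<^sub>2 (bimarginal n a b B))"
      using \<kappa> conc_le_bimarginal[OF A B le] bimarginal_in_Cop[OF A] bimarginal_in_Cop[OF B]
      by (intro sum_mono) (auto simp: scarsini_measure_def)
    then show ?thesis using c by (simp add: avg[OF n A] avg[OF n B] divide_right_mono)
  qed
  show "(\<lambda>m. \<kappa> n (Cm m)) \<longlonglongrightarrow> \<kappa> n C"
    if Cm: "\<forall>m. Cm m \<in> Cop n" and C: "C \<in> Cop n" and lim: "uniform_limit (icube n) Cm C sequentially"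
    for Cm C
  proof -
    have cont: "\<forall>F D. (\<forall>m. F m \<in> Cop 2) \<longrightarrow> D \<in> Cop 2 \<longrightarrow>
        uniform_limit (icube 2) F D sequentially \<longrightarrow> (\<lambda>m. \<kappa>\<^sub>2 (F m)) \<longlonglongrightarrow> \<kappa>\<^sub>2 D"
      using \<kappa> unfolding scarsini_measure_def by (elim conjE)
    have lim2: "(\<lambda>m. \<kappa>\<^sub>2 (bimarginal n a b (Cm m))) \<longlonglongrightarrow> \<kappa>\<^sub>2 (bimarginal n a b C)"
      if ab: "(a, b) \<in> ?P" for a b
    proof -
      have "uniform_limit (icube 2) (\<lambda>m. bimarginal n a b (Cm m)) (bimarginal n a b C) sequentially"
        using uniform_limit_bimarginal[OF _ C lim ab] Cm by blast
      moreover have "\<forall>m. bimarginal n a b (Cm m) \<in> Cop 2" "bimarginal n a b C \<in> Cop 2"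
        using Cm C bimarginal_in_Cop[OF _ ab] by auto
      ultimately show ?thesis
        using cont[rule_format, of "\<lambda>m. bimarginal n a b (Cm m)"] by blast
    qed
    have "(\<lambda>m. \<Sum>(a, b)\<in>?P. \<kappa>\<^sub>2 (bimarginal n a b (Cm m))) \<longlonglongrightarrow>
        (\<Sum>(a, b)\<in>?P. \<kappa>\<^sub>2 (bimarginal n a b C))"
      by (rule tendsto_sum) (auto simp: lim2)
    then have "(\<lambda>m. (\<Sum>(a, b)\<in>?P. \<kappa>\<^sub>2 (bimarginal n a b (Cm m))) / ?c) \<longlonglongrightarrow>
        (\<Sum>(a, b)\<in>?P. \<kappa>\<^sub>2 (bimarginal n a b C)) / ?c"
      using n by (intro tendsto_divide tendsto_const) auto
    then show ?thesis using Cm by (simp only: avg[OF n C] avg[OF n])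
  qed
  show "\<kappa> n (pull n \<tau> C) = \<kappa> n C" if C: "C \<in> Cop n" and \<tau>: "\<tau> \<in> permutations_of_cube n" for C \<tau>
  proof -
    obtain t where t: "\<tau> = perm_map t" "t permutes {1..n}"
      using \<tau> by (auto simp: permutations_of_cube_def)
    have t': "inv t permutes {1..n}" by (rule permutes_inv[OF t(2)])
    have \<tau>C: "pull n \<tau> C \<in> Cop n"
      unfolding t(1) pull_perm_map[OF C t(2)] using t'
      by (intro transport_in_Cop[OF C]) (simp add: permutes_imp_bij bij_betw_imp_funcset)
    have "(\<Sum>(a, b)\<in>?P. \<kappa>\<^sub>2 (bimarginal n a b (pull n \<tau> C))) =
        (\<Sum>(a, b)\<in>?P. \<kappa>\<^sub>2 (bimarginal n (inv t a) (inv t b) C))"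
      by (rule sum.cong) (auto simp: t(1) pull_permutation_bimarginal[OF C t(2)])
    \<comment> \<open>Applying one permutation to both entries keeps them distinct, so it permutes
      the index set of the sum.\<close>
    also have "\<dots> = (\<Sum>(a, b)\<in>?P. \<kappa>\<^sub>2 (bimarginal n a b C))"
      by (rule sum.reindex_bij_witness[of _ "map_prod t t" "map_prod (inv t) (inv t)"])
        (auto simp: ordered_pairs_def permutes_inverses[OF t(2)] inj_eq[OF permutes_inj[OF t(2)]]
          inj_eq[OF permutes_inj[OF t']]
          simp del: atLeastAtMost_iff simp: permutes_in_image[OF t(2)] permutes_in_image[OF t'])
    finally show ?thesis by (simp add: avg[OF n C] avg[OF n \<tau>C])
  qed
  show "\<kappa> n (pull n (full_refl n) C) = \<kappa> n C" if C: "C \<in> Cop n" for C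
  proof -
    let ?C' = "pull n (reflect_on {1..n}) C"
    have C': "?C' \<in> Cop n" by (rule pull_refl_Cop[OF C order_refl])
    have "\<kappa>\<^sub>2 (bimarginal n a b ?C') = \<kappa>\<^sub>2 (bimarginal n a b C)" if ab: "(a, b) \<in> ?P" for a b
    proof -
      \<comment> \<open>The full reflection marks both positions. The marks are removed one at a
        time, with only position 2 marked in between, and the two signs cancel.\<close>
      have "\<kappa>\<^sub>2 (bimarginal n a b ?C') = - \<kappa>\<^sub>2 (transport n 2 (pair_index a b) (\<lambda>i. i = 2) C)"
        unfolding pull_reflect_on_bimarginal[OF C order_refl ab]
        by (rule scarsini_flip[OF \<kappa> C ab, where k = 1])
          (use ab in \<open>auto simp: pair_index_def ordered_pairs_def\<close>)
      also have "\<kappa>\<^sub>2 (transport n 2 (pair_index a b) (\<lambda>i. i = 2) C) = - \<kappa>\<^sub>2 (bimarginal n a b C)"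
        by (rule scarsini_flip[OF \<kappa> C ab, where k = 2]) auto
      finally show ?thesis by simp
    qed
    then have "(\<Sum>(a, b)\<in>?P. \<kappa>\<^sub>2 (bimarginal n a b ?C')) = (\<Sum>(a, b)\<in>?P. \<kappa>\<^sub>2 (bimarginal n a b C))"
      by (intro sum.cong) auto
    then show ?thesis by (simp add: full_refl_eq_reflect_on avg[OF n C] avg[OF n C'])
  qed
  show "(\<Sum>\<rho>\<in>reflections n. \<kappa> n (pull n \<rho> C)) = 0" if C: "C \<in> Cop n" for C
  proof -
    have "(\<Sum>\<rho>\<in>reflections n. \<kappa> n (pull n \<rho> C)) =
        (\<Sum>\<rho>\<in>reflections n. (\<Sum>(a, b)\<in>?P. \<kappa>\<^sub>2 (bimarginal n a b (pull n \<rho> C))) / ?c)"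
      by (rule sum.cong) (auto simp: reflections_eq intro!: avg[OF n] pull_refl_Cop[OF C])
    \<comment> \<open>Exchanging the sums fixes a pair while the reflection varies, and each inner
      sum vanishes.\<close>
    also have "\<dots> = (\<Sum>(a, b)\<in>?P. \<Sum>\<rho>\<in>reflections n. \<kappa>\<^sub>2 (bimarginal n a b (pull n \<rho> C))) / ?c"
      unfolding sum_divide_distrib[symmetric] case_prod_beta by (subst sum.swap) (rule refl)
    also have "\<dots> = 0"
      using sum_reflections_eq_0[OF \<kappa> C] by (simp add: sum.neutral case_prod_beta)
    finally show ?thesis .
  qed
  show "r n * \<kappa> n C = \<kappa> (n + 1) E + \<kappa> (n + 1) (pull (n + 1) (elem_refl 1) E)"
    if C: "C \<in> Cop n" and E: "E \<in> Cop (n + 1)" and CE: "\<forall>x\<in>icube n. C x = E (cons_one n x)" for C E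
  proof -
    have E': "pull (n + 1) (elem_refl 1) E \<in> Cop (n + 1)"
      unfolding elem_refl_eq_reflect_on by (rule pull_refl_Cop[OF E]) auto
    have n': "n + 1 \<ge> 2" using n by simp
    \<comment> \<open>The hypothesis indexes \<open>r\<close> by \<open>1 + p\<close>, so dimension
      \<open>n\<close> means \<open>p = n - 1\<close>.\<close>
    have r: "r n = 2 * (real n - 1) / (real n + 1)"
      using assms(4)[of "n - 1"] n by (simp add: of_nat_diff)
    \<comment> \<open>With \<open>x\<close> for \<open>n\<close>, the left side divides by the
      \<open>(n + 1) * n\<close> pairs of dimension \<open>n + 1\<close>, the right side by the
      \<open>n * (n - 1)\<close> pairs of dimension \<open>n\<close>. Twice the quotient of the
      smaller count by the larger is \<open>r n\<close>.\<close>
    have cancel: "2 * s / ((x + 1) * x) = 2 * (x - 1) / (x + 1) * (s / (x * (x - 1)))" if "x \<ge> 2"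
      for s x :: real
      using that by (simp add: divide_simps)
    let ?S = "\<Sum>(a, b)\<in>?P. \<kappa>\<^sub>2 (bimarginal n a b C)"
    have "\<kappa> (n + 1) E + \<kappa> (n + 1) (pull (n + 1) (elem_refl 1) E) = 2 * ?S / ((real n + 1) * real n)"
      unfolding avg[OF n' E] avg[OF n' E'] add_divide_distrib[symmetric]
      using sum_transition[OF \<kappa> C E CE[rule_format]] by simp
    also have "\<dots> = r n * (?S / ?c)"
      unfolding r by (rule cancel) (use n in simp)
    finally show ?thesis by (simp add: avg[OF n C])
  qed
qed

end
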